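(* Let $G$ be a finite directed acyclic graph with vertex set $V$ and edge set $D$, let $i_0,j_0\in V$ be distinct, and let $S\subseteq V\setminus\{i_0,j_0\}$. Let $f=\det(\Sigma[S\cup\{i_0\},S\cup\{j_0\}])\in\mathbb{R}[a_{ij}\mid (i,j)\in D]$, where $\Sigma=(I-A)^{-T}(I-A)^{-1}$ is the covariance matrix of the directed Gaussian graphical model of $G$ with unit error variances, and assume that $f$ is not identically zero on $\mathbb{R}^D$. Let $H_f\subseteq\mathbb{R}^D$ be the zero locus of $f$. Assume that $i_0\to j_0$ and that for all $s\in S$ below $j_0$ we have $i_0\to s$. Then $H_f$ is nonsingular.
   Context: $D\subseteq\{(i,j)\in V^2\mid i\neq j\}$; we write $i\to j$ if $(i,j)\in D$. A path from $i$ to $j$ of length $k\ge 0$ is a sequence $(i=i_0,i_1,\dots,i_k=j)$ with $i_l\to i_{l+1}$ for all $l=0,\dots,k-1$. A vertex $j$ is below $i$ if there is a path from $i$ to $j$ of length at least $1$. $A$ is the $V\times V$ matrix whose $(i,j)$-entry is the variable (real parameter) $a_{ij}$ if $i\to j$ and $0$ otherwise; it is nilpotent, so the entries of $\Sigma=(I-A)^{-T}(I-A)^{-1}$ are polynomials in the $a_{ij}$. For $K,L\subseteq V$, $\Sigma[K,L]$ is the $K\times L$ submatrix of $\Sigma$ (rows and columns ordered by a fixed linear order on $V$). $H_f$ is called nonsingular if there is no point of $\mathbb{R}^D$ at which $f$ and all its partial derivatives $\partial f/\partial a_{ij}$, $(i,j)\in D$, vanish simultaneously. *)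

theory Defs
  imports "Jordan_Normal_Form.Determinant" "HOL-Analysis.Analysis"
begin

(* Both matrix libraries define mat, det and the infix $; below, $ and the unqualified names
   are those of HOL-Analysis. *)
no_notation Matrix.vec_index (infixl "$" 100)

(* R^D: functions on D, extended by the dummy value undefined outside D. *)
definition parameter_space :: "('v \<times> 'v) set \<Rightarrow> ('v \<times> 'v \<Rightarrow> real) set" where
  "parameter_space D = (D \<rightarrow>\<^sub>E UNIV)"

definition weight_matrix :: "('v::finite \<times> 'v) set \<Rightarrow> ('v \<times> 'v \<Rightarrow> real) \<Rightarrow> real^'v^'v" where
  "weight_matrix D a = (\<chi> i j. if (i, j) \<in> D then a (i, j) else 0)"

definition covariance_matrix :: "('v::finite \<times> 'v) set \<Rightarrow> ('v \<times> 'v \<Rightarrow> real) \<Rightarrow> real^'v^'v" where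
  "covariance_matrix D a =
     Finite_Cartesian_Product.transpose (matrix_inv (Finite_Cartesian_Product.mat 1 - weight_matrix D a)) **
     matrix_inv (Finite_Cartesian_Product.mat 1 - weight_matrix D a)"

(* M[K,L]. The Jordan_Normal_Form matrices carry their dimensions as numbers, so that the index
   sets K and L may differ; rows and columns are listed in increasing order. *)
definition sub_matrix ::
    "real^('v::{finite,linorder})^('v::{finite,linorder}) \<Rightarrow> 'v set \<Rightarrow> 'v set \<Rightarrow> real Matrix.mat" where
  "sub_matrix M K L =
     Matrix.mat (card K) (card L)
       (\<lambda>(r, c). M $ (sorted_list_of_set K ! r) $ (sorted_list_of_set L ! c))"

(* det(Sigma[S + i, S + j]) as a function on R^D. For acyclic D this is a polynomial function,
   and a real polynomial is determined by the function it defines on R^D. *)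
definition conditional_minor ::
    "('v::{finite,linorder} \<times> 'v) set \<Rightarrow> 'v \<Rightarrow> 'v \<Rightarrow> 'v set \<Rightarrow> ('v \<times> 'v \<Rightarrow> real) \<Rightarrow> real" where
  "conditional_minor D i j S a =
     Determinant.det (sub_matrix (covariance_matrix D a) (insert i S) (insert j S))"

definition zero_locus ::
    "('v \<times> 'v) set \<Rightarrow> (('v \<times> 'v \<Rightarrow> real) \<Rightarrow> real) \<Rightarrow> ('v \<times> 'v \<Rightarrow> real) set" where
  "zero_locus D f = {a \<in> parameter_space D. f a = 0}"

definition partial_deriv ::
    "('v \<times> 'v) \<Rightarrow> (('v \<times> 'v \<Rightarrow> real) \<Rightarrow> real) \<Rightarrow> ('v \<times> 'v \<Rightarrow> real) \<Rightarrow> real" where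
  "partial_deriv e f a = deriv (\<lambda>t. f (a(e := t))) (a e)"

(* Nonsingularity of the zero locus of f with respect to the defining function f; it is only
   used for polynomial functions f, whose partial derivatives exist everywhere. *)
definition nonsingular_hypersurface ::
    "('v \<times> 'v) set \<Rightarrow> (('v \<times> 'v \<Rightarrow> real) \<Rightarrow> real) \<Rightarrow> bool" where
  "nonsingular_hypersurface D f \<longleftrightarrow>
     \<not> (\<exists>a \<in> zero_locus D f. \<forall>e\<in>D. partial_deriv e f a = 0)"

end

theory Submission imports Defs begin

text \<open>
  Let \<open>B\<close> be the inverse of \<open>I - A\<close>. Changing a single weight \<open>a (i\<^sub>0, m)\<close> by \<open>s\<close> replaces \<open>B\<close> by
  \<open>B + s b r\<close>, where \<open>b\<close> is column \<open>i\<^sub>0\<close> and \<open>r\<close> is row \<open>m\<close> of \<open>B\<close>; the random variable \<open>X l\<close>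
  becomes \<open>X l + s r l X i\<^sub>0\<close>. Since \<open>r i\<^sub>0 = 0\<close>, row operations with row \<open>i\<^sub>0\<close> turn the changed minor
  into a rank one update in the columns, so \<open>f\<close> is affine in \<open>s\<close> with slope \<open>\<Sum>l. B m l * c l\<close>, where
  \<open>c l\<close> is the minor with column \<open>l\<close> replaced by column \<open>i\<^sub>0\<close> of \<open>\<Sigma>\<close>. In particular \<open>c j\<^sub>0\<close> is, up to
  sign, the positive principal minor \<open>\<Sigma>[S + i\<^sub>0, S + i\<^sub>0]\<close>. Let \<open>U\<close> consist of \<open>j\<^sub>0\<close> and the elements of
  \<open>S\<close> below it; all \<open>i\<^sub>0 \<rightarrow> m\<close> with \<open>m \<in> U\<close> are edges. If the corresponding partial derivatives all
  vanished, then \<open>c\<close> would vanish on \<open>U\<close>, because \<open>B\<close> is unitriangular on \<open>U\<close> and no element of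
  \<open>S - U\<close> is below \<open>U\<close>.
\<close>

section \<open>Determinant updates and nonsingular principal submatrices\<close>

lemma det_rank_one_update:
  fixes A :: "'a::idom Matrix.mat"
  assumes A: "A \<in> carrier_mat n n"
  shows "Determinant.det (A + Matrix.mat n n (\<lambda>(r, c). v r * u c)) =
    Determinant.det A - (\<Sum>c<n. u c *
      cofactor (four_block_mat A (Matrix.mat n 1 (\<lambda>(r, _). v r)) (0\<^sub>m 1 n) (1\<^sub>m 1)) n c)"
proof -
  \<comment> \<open>Both sides are the determinant of the bordered matrix \<open>[A, v; - u, 1]\<close>: clear its last row, or
    expand along it.\<close>
  define V where "V = Matrix.mat n 1 (\<lambda>(r, _::nat). v r)"
  define U where "U = Matrix.mat 1 n (\<lambda>(_::nat, c). u c)"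
  define W where "W = four_block_mat A V (- U) (1\<^sub>m 1)"
  \<comment> \<open>Right multiplication by \<open>T\<close> adds \<open>u c\<close> times the last
    column to column \<open>c\<close>, which clears \<open>- U\<close>.\<close>
  define T where "T = four_block_mat (1\<^sub>m n) (0\<^sub>m n 1) U (1\<^sub>m 1)"
  have V: "V \<in> carrier_mat n 1" and U: "U \<in> carrier_mat 1 n"
    by (auto simp: V_def U_def)
  have W: "W \<in> carrier_mat (Suc n) (Suc n)" and T: "T \<in> carrier_mat (Suc n) (Suc n)"
    using A V U by (auto simp: W_def T_def)
  have VU: "V * U = Matrix.mat n n (\<lambda>(r, c). v r * u c)"
    by (rule eq_matI) (auto simp: V_def U_def scalar_prod_def)
  have "W * T = four_block_mat (A * 1\<^sub>m n + V * U) (A * 0\<^sub>m n 1 + V * 1\<^sub>m 1)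
      (- U * 1\<^sub>m n + 1\<^sub>m 1 * U) (- U * 0\<^sub>m n 1 + 1\<^sub>m 1 * 1\<^sub>m 1)"
    unfolding W_def T_def by (rule mult_four_block_mat) (use A V U in auto)
  also have "\<dots> = four_block_mat (A + V * U) V (0\<^sub>m 1 n) (1\<^sub>m 1)"
    by (rule cong_four_block_mat) (use A V U in auto)
  finally have "Determinant.det (W * T) = Determinant.det (A + V * U)"
    using A V U by (subst (asm) eq_commute)
      (auto simp: det_four_block_mat_lower_left_zero[of _ n _ 1] dest: sym)
  moreover have "Determinant.det T = 1"
    using U by (simp add: T_def det_four_block_mat_upper_right_zero_col[of _ n])
  ultimately have "Determinant.det (A + V * U) = Determinant.det W"
    using W T by (simp add: det_mult)
  also have "\<dots> = (\<Sum>c<Suc n. W $$ (n, c) * cofactor W n c)"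
    by (rule laplace_expansion_row[OF W]) simp
  also have "\<dots> = (\<Sum>c<n. W $$ (n, c) * cofactor W n c) + W $$ (n, n) * cofactor W n n"
    by simp
  also have "mat_delete W n n = A"
    using A V U by (intro eq_matI) (auto simp: mat_delete_def W_def)
  then have "W $$ (n, n) * cofactor W n n = Determinant.det A"
    using A V U by (simp add: W_def cofactor_def)
  also have "(\<Sum>c<n. W $$ (n, c) * cofactor W n c) =
      (\<Sum>c<n. - (u c * cofactor (four_block_mat A V (0\<^sub>m 1 n) (1\<^sub>m 1)) n c))"
  proof (rule sum.cong)
    fix c assume c: "c \<in> {..<n}"
    \<comment> \<open>Cofactors along the last row do not see that row, so \<open>- U\<close> may be
      replaced by zeros; the cofactors are then independent of \<open>u\<close>.\<close>
    have "mat_delete W n c = mat_delete (four_block_mat A V (0\<^sub>m 1 n) (1\<^sub>m 1)) n c"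
      using A V U c by (intro eq_matI) (auto simp: mat_delete_def W_def)
    then show "W $$ (n, c) * cofactor W n c =
        - (u c * cofactor (four_block_mat A V (0\<^sub>m 1 n) (1\<^sub>m 1)) n c)"
      using A V U c by (simp add: W_def U_def cofactor_def)
  qed simp
  finally show ?thesis
    unfolding VU by (simp add: sum_negf V_def)
qed

lemma det_add_multiples_of_row:
  fixes A :: "'a::comm_ring_1 Matrix.mat"
  assumes A: "A \<in> carrier_mat n n" and p: "p < n" and x: "x p = 0"
  shows "Determinant.det (Matrix.mat n n (\<lambda>(r, c). A $$ (r, c) + x r * A $$ (p, c))) = Determinant.det A"
proof -
  define E where "E = Matrix.mat n n (\<lambda>(r, c). (if r = c then 1 else 0) + (if c = p then x r else 0))"
  have E: "E \<in> carrier_mat n n" by (simp add: E_def)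
  have "Matrix.mat n n (\<lambda>(r, c). A $$ (r, c) + x r * A $$ (p, c)) = E * A"
    using A p by (intro eq_matI)
      (auto simp: E_def scalar_prod_def algebra_simps sum.distrib if_distrib [of "\<lambda>y. _ * y"] cong: if_cong)
  moreover have "Determinant.det E = 1"
  proof -
    have "Determinant.det E = (\<Sum>c<n. E $$ (p, c) * cofactor E p c)"
      by (rule laplace_expansion_row[OF E p])
    \<comment> \<open>As \<open>x p = 0\<close>, row \<open>p\<close> of \<open>E\<close> is a unit
      vector.\<close>
    also have "\<dots> = (\<Sum>c<n. if c = p then cofactor E p p else 0)"
      using p x by (intro sum.cong) (auto simp: E_def)
    also have "\<dots> = Determinant.det (mat_delete E p p)"
      using p by (simp add: cofactor_def)
    also have "mat_delete E p p = 1\<^sub>m (n - 1)"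
      using p by (intro eq_matI) (auto simp: mat_delete_def E_def)
    finally show ?thesis by simp
  qed
  ultimately show ?thesis using det_mult[OF E A] by simp
qed

text \<open>A kernel vector, placed on \<open>P\<close> along \<open>l\<close> and extended by zero,
  gives \<open>x\<close> vanishing off \<open>P\<close> with \<open>M *v x\<close> vanishing on
  \<open>P\<close>, hence \<open>x \<bullet> (M *v x) = 0\<close>. Separate enumerations
  \<open>k\<close> and \<open>l\<close> allow rows and columns in different orders, so no
  permutation sign has to be tracked.\<close>

lemma det_reindexed_principal_ne_0:
  fixes M :: "real^'v^'v"
  assumes def: "\<And>x. x \<noteq> 0 \<Longrightarrow> x \<bullet> (M *v x) \<noteq> 0"
    and k: "bij_betw k {..<n} P" and l: "bij_betw l {..<n} P"
  shows "Determinant.det (Matrix.mat n n (\<lambda>(r, c). M $ k r $ l c)) \<noteq> 0"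
proof
  let ?Q = "Matrix.mat n n (\<lambda>(r, c). M $ k r $ l c)"
  assume "Determinant.det ?Q = 0"
  then obtain y where y: "y \<in> carrier_vec n" "y \<noteq> 0\<^sub>v n" "?Q *\<^sub>v y = 0\<^sub>v n"
    using det_0_iff_vec_prod_zero[of ?Q n] by auto
  define x :: "real^'v" where
    "x = (\<chi> i. if i \<in> P then vec_index y (the_inv_into {..<n} l i) else 0)"
  have xl: "x $ l c = vec_index y c" if "c < n" for c
    using l that by (auto simp: x_def bij_betw_def the_inv_into_f_f)
  have x0: "x $ i = 0" if "i \<notin> P" for i using that by (simp add: x_def)
  have row: "(M *v x) $ k r = 0" if "r < n" for r
  proof -
    have "(M *v x) $ k r = (\<Sum>i\<in>P. M $ k r $ i * x $ i)"
      unfolding matrix_vector_mult_def by (simp, intro sum.mono_neutral_right) (auto simp: x0)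
    also have "\<dots> = (\<Sum>c<n. M $ k r $ l c * x $ l c)"
      by (rule sum.reindex_bij_betw[OF l, symmetric])
    also have "\<dots> = vec_index (?Q *\<^sub>v y) r"
      using y(1) that by (auto simp: xl scalar_prod_def lessThan_atLeast0)
    finally show ?thesis using y that by simp
  qed
  have "x $ i * (M *v x) $ i = 0" for i
    using k row x0 by (cases "i \<in> P") (auto simp: bij_betw_def)
  then have "x \<bullet> (M *v x) = 0"
    unfolding inner_vec_def by (intro sum.neutral) (auto simp: inner_real_def)
  with def have "x = 0" by blast
  then have "y = 0\<^sub>v n" using xl y by (intro eq_vecI) auto
  with y show False by simp
qed

section \<open>The inverse of \<open>I - A\<close> and its dependence on one weight\<close>

text \<open>For acyclic \<open>D\<close>, entry \<open>(k, l)\<close> is the sum over all paths from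
  \<open>k\<close> to \<open>l\<close> of the products of their edge weights.\<close>

definition path_matrix :: "('v::finite \<times> 'v) set \<Rightarrow> ('v \<times> 'v \<Rightarrow> real) \<Rightarrow> real^'v^'v" where
  "path_matrix D a = matrix_inv (Finite_Cartesian_Product.mat 1 - weight_matrix D a)"

text \<open>Induction from the sinks upwards. The hypothesis covers all proper descendants, not only
  successors, as the final argument requires.\<close>

lemma finite_acyclic_converse_induct:
  fixes D :: "('v::finite \<times> 'v) set"
  assumes "acyclic D"
    and step: "\<And>i. (\<And>j. (i, j) \<in> D\<^sup>+ \<Longrightarrow> P j) \<Longrightarrow> P i"
  shows "P i"
proof -
  have "wf ((D\<inverse>)\<^sup>+)"
    using assms(1) by (intro wf_trancl finite_acyclic_wf) (auto simp: acyclic_converse)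
  then show ?thesis
    by (rule wf_induct_rule) (auto simp: trancl_converse intro: step)
qed

lemma matrix_inv_inverse:
  fixes A :: "'a::semiring_1^'n^'m"
  assumes "invertible A"
  shows matrix_inv_right: "A ** matrix_inv A = Finite_Cartesian_Product.mat 1"
    and matrix_inv_left: "matrix_inv A ** A = Finite_Cartesian_Product.mat 1"
  using someI_ex[OF assms[unfolded invertible_def]] by (simp_all add: matrix_inv_def)

text \<open>The entrywise form splits paths by their first step: a path is empty or starts with an
  edge from \<open>k\<close> to \<open>p\<close>.\<close>

lemma recursion_eq_iff_matrix_mult:
  "(Finite_Cartesian_Product.mat 1 - A) ** X = Finite_Cartesian_Product.mat 1 \<longleftrightarrow>
    (\<forall>k l. X $ k $ l = (if k = l then 1 else 0) + (\<Sum>p\<in>UNIV. A $ k $ p * X $ p $ l))"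
  for A X :: "real^'v^'v"
proof -
  have "((Finite_Cartesian_Product.mat 1 - A) ** X) $ k $ l = X $ k $ l - (\<Sum>p\<in>UNIV. A $ k $ p * X $ p $ l)" for k l
    by (simp add: matrix_matrix_mult_def Finite_Cartesian_Product.mat_def left_diff_distrib
        sum_subtractf if_distrib[of "\<lambda>y. y * _"] cong: if_cong)
  then show ?thesis
    by (simp only: Finite_Cartesian_Product.vec_eq_iff Finite_Cartesian_Product.mat_def vec_lambda_beta
        diff_eq_eq)
qed

text \<open>A kernel vector satisfies \<open>x = A x\<close>, so each entry is a combination of the
  entries at successors and vanishes by induction.\<close>

lemma invertible_one_minus_weight_matrix:
  fixes D :: "('v::finite \<times> 'v) set"
  assumes "acyclic D"
  shows "invertible (Finite_Cartesian_Product.mat 1 - weight_matrix D a)"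
proof -
  have "x = 0" if x: "(Finite_Cartesian_Product.mat 1 - weight_matrix D a) *v x = 0" for x
  proof -
    have "((Finite_Cartesian_Product.mat 1 - weight_matrix D a) *v x) $ i =
        x $ i - (\<Sum>j\<in>UNIV. weight_matrix D a $ i $ j * x $ j)" for i
      by (simp add: matrix_vector_mult_def
          Finite_Cartesian_Product.mat_def left_diff_distrib sum_subtractf
          if_distrib[of "\<lambda>y. y * _"] cong: if_cong)
    then have rec: "x $ i = (\<Sum>j\<in>UNIV. weight_matrix D a $ i $ j * x $ j)" for i
      using x by (metis eq_iff_diff_eq_0 zero_index)
    have "x $ i = 0" for i
    proof (rule finite_acyclic_converse_induct[OF assms, where P = "\<lambda>i. x $ i = 0"])
      fix i assume "\<And>j. (i, j) \<in> D\<^sup>+ \<Longrightarrow> x $ j = 0"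
      then show "x $ i = 0"
        by (subst rec) (auto intro!: sum.neutral simp: weight_matrix_def r_into_trancl)
    qed
    then show ?thesis by (simp add: Finite_Cartesian_Product.vec_eq_iff)
  qed
  then show ?thesis
    by (simp add: invertible_left_inverse matrix_left_invertible_ker)
qed

text \<open>Lets a formula for the inverse be verified through the recursion alone, by uniqueness of
  inverses.\<close>

lemma path_matrix_eqI:
  fixes D :: "('v::finite \<times> 'v) set"
  assumes "acyclic D"
    and X: "\<And>k l. X $ k $ l = (if k = l then 1 else 0) + (\<Sum>p\<in>UNIV. weight_matrix D a $ k $ p * X $ p $ l)"
  shows "path_matrix D a = X"
proof -
  let ?M = "Finite_Cartesian_Product.mat 1 - weight_matrix D a"
  have "?M ** X = Finite_Cartesian_Product.mat 1"
    unfolding recursion_eq_iff_matrix_mult using X by blast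
  moreover have "path_matrix D a ** ?M = Finite_Cartesian_Product.mat 1"
    unfolding path_matrix_def
    by (rule matrix_inv_left) (rule invertible_one_minus_weight_matrix[OF assms(1)])
  ultimately show ?thesis
    by (metis matrix_mul_assoc matrix_mul_lid matrix_mul_rid)
qed

lemma path_matrix_rec:
  fixes D :: "('v::finite \<times> 'v) set"
  assumes "acyclic D"
  shows "path_matrix D a $ k $ l =
    (if k = l then 1 else 0) + (\<Sum>p\<in>UNIV. weight_matrix D a $ k $ p * path_matrix D a $ p $ l)"
proof -
  have "(Finite_Cartesian_Product.mat 1 - weight_matrix D a) ** path_matrix D a = Finite_Cartesian_Product.mat 1"
    unfolding path_matrix_def
    by (rule matrix_inv_right) (rule invertible_one_minus_weight_matrix[OF assms(1)])
  then show ?thesis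
    unfolding recursion_eq_iff_matrix_mult by blast
qed

text \<open>If \<open>k\<close> does not reach \<open>l\<close>, then \<open>k \<noteq> l\<close>
  and no successor of \<open>k\<close> reaches \<open>l\<close>, so every term of the recursion
  vanishes.\<close>

lemma path_matrix_support:
  fixes D :: "('v::finite \<times> 'v) set"
  assumes D: "acyclic D" and "path_matrix D a $ k $ l \<noteq> 0"
  shows "(k, l) \<in> D\<^sup>*"
proof -
  have "path_matrix D a $ k $ l \<noteq> 0 \<longrightarrow> (k, l) \<in> D\<^sup>*"
  proof (rule finite_acyclic_converse_induct[OF D, where P = "\<lambda>k. path_matrix D a $ k $ l \<noteq> 0 \<longrightarrow> (k, l) \<in> D\<^sup>*"])
    fix k
    assume IH: "\<And>p. (k, p) \<in> D\<^sup>+ \<Longrightarrow> path_matrix D a $ p $ l \<noteq> 0 \<longrightarrow> (p, l) \<in> D\<^sup>*"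
    show "path_matrix D a $ k $ l \<noteq> 0 \<longrightarrow> (k, l) \<in> D\<^sup>*"
    proof (rule impI, rule ccontr)
      assume nz: "path_matrix D a $ k $ l \<noteq> 0" and nr: "(k, l) \<notin> D\<^sup>*"
      have "weight_matrix D a $ k $ p * path_matrix D a $ p $ l = 0" for p
        using IH[of p] nr by (auto simp: weight_matrix_def intro: converse_rtrancl_into_rtrancl)
      with nr nz path_matrix_rec[OF D, of a k l] show False by (auto split: if_splits)
    qed
  qed
  with assms show ?thesis by blast
qed

text \<open>A nonzero term of the recursion would give an edge from \<open>k\<close> to
  \<open>p\<close> and a path back, a cycle; only the empty path remains.\<close>

lemma path_matrix_diag:
  fixes D :: "('v::finite \<times> 'v) set"
  assumes D: "acyclic D"
  shows "path_matrix D a $ k $ k = 1"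
proof -
  have "weight_matrix D a $ k $ p * path_matrix D a $ p $ k = 0" for p
  proof (rule ccontr)
    assume nz: "weight_matrix D a $ k $ p * path_matrix D a $ p $ k \<noteq> 0"
    then have "(k, p) \<in> D" by (auto simp: weight_matrix_def split: if_splits)
    moreover have "(p, k) \<in> D\<^sup>*" using nz path_matrix_support[OF D] by auto
    ultimately show False using D by (meson acyclic_def rtrancl_into_trancl2)
  qed
  then have "(\<Sum>p\<in>UNIV. weight_matrix D a $ k $ p * path_matrix D a $ p $ k) = 0"
    by (intro sum.neutral) auto
  then show ?thesis by (subst path_matrix_rec[OF D]) simp
qed

text \<open>The Sherman--Morrison formula, without denominator because no path returns from \<open>m\<close> to \<open>i\<close>.\<close>

lemma path_matrix_update:
  fixes D :: "('v::finite \<times> 'v) set"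
  assumes D: "acyclic D" and e: "(i, m) \<in> D"
  shows "path_matrix D (a((i, m) := t)) $ k $ l =
    path_matrix D a $ k $ l + (t - a (i, m)) * path_matrix D a $ k $ i * path_matrix D a $ m $ l"
proof -
  let ?B = "path_matrix D a" and ?W = "weight_matrix D a"
  define s where "s = t - a (i, m)"
  define X :: "real^'v^'v" where "X = (\<chi> k l. ?B $ k $ l + s * ?B $ k $ i * ?B $ m $ l)"
  have "(m, i) \<notin> D\<^sup>*"
    using D e by (meson acyclic_def rtrancl_into_trancl2)
  then have "?B $ m $ i = 0"
    using path_matrix_support[OF D] by blast
  then have Xm: "X $ m $ l = ?B $ m $ l" for l by (simp add: X_def)
  have W: "weight_matrix D (a((i, m) := t)) $ k $ p =
      ?W $ k $ p + (if p = m then if k = i then s else 0 else 0)" for k p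
    using e by (auto simp: weight_matrix_def s_def)
  have "path_matrix D (a((i, m) := t)) = X"
  proof (rule path_matrix_eqI[OF D])
    fix k l
    have "(\<Sum>p\<in>UNIV. weight_matrix D (a((i, m) := t)) $ k $ p * X $ p $ l) =
        (\<Sum>p\<in>UNIV. ?W $ k $ p * X $ p $ l + (if p = m then (if k = i then s else 0) * X $ p $ l else 0))"
      by (rule sum.cong) (auto simp: W distrib_right)
    also have "\<dots> = (\<Sum>p\<in>UNIV. ?W $ k $ p * X $ p $ l) + (if k = i then s else 0) * X $ m $ l"
      by (simp add: sum.distrib)
    also have "(\<Sum>p\<in>UNIV. ?W $ k $ p * X $ p $ l) =
        (\<Sum>p\<in>UNIV. ?W $ k $ p * ?B $ p $ l) + (\<Sum>p\<in>UNIV. ?W $ k $ p * ?B $ p $ i) * (s * ?B $ m $ l)"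
      unfolding sum_distrib_right sum.distrib[symmetric]
      by (rule sum.cong[OF refl]) (simp add: X_def algebra_simps)
    finally have sum_eq: "(\<Sum>p\<in>UNIV. weight_matrix D (a((i, m) := t)) $ k $ p * X $ p $ l) =
        (\<Sum>p\<in>UNIV. ?W $ k $ p * ?B $ p $ l) + (\<Sum>p\<in>UNIV. ?W $ k $ p * ?B $ p $ i) * (s * ?B $ m $ l) +
        (if k = i then s else 0) * ?B $ m $ l"
      by (simp only: Xm)
    have X_kl: "X $ k $ l = ?B $ k $ l + ?B $ k $ i * (s * ?B $ m $ l)"
      by (simp add: X_def)
    show "X $ k $ l = (if k = l then 1 else 0) +
        (\<Sum>p\<in>UNIV. weight_matrix D (a((i, m) := t)) $ k $ p * X $ p $ l)"
      \<comment> \<open>Expanding \<open>?B $ k $ i\<close> too produces, from its diagonal term,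
        exactly the contribution of the changed entry \<open>(i, m)\<close>.\<close>
      unfolding X_kl sum_eq path_matrix_rec[OF D, of a k l] path_matrix_rec[OF D, of a k i]
      by (simp add: distrib_right)
  qed
  then show ?thesis by (simp add: X_def s_def)
qed

section \<open>Definiteness and update of the covariance matrix\<close>

lemma covariance_matrix_nth:
  "covariance_matrix D a $ k $ l = (\<Sum>p\<in>UNIV. path_matrix D a $ p $ k * path_matrix D a $ p $ l)"
  by (simp add: covariance_matrix_def path_matrix_def matrix_matrix_mult_def
      Finite_Cartesian_Product.transpose_def)

text \<open>The quadratic form is the squared norm of \<open>path_matrix D a *v x\<close>, and the
  path matrix is invertible.\<close>

lemma covariance_matrix_definite:
  fixes D :: "('v::finite \<times> 'v) set"
  assumes D: "acyclic D" and "x \<noteq> 0"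
  shows "x \<bullet> (covariance_matrix D a *v x) \<noteq> 0"
proof
  let ?B = "path_matrix D a"
  assume "x \<bullet> (covariance_matrix D a *v x) = 0"
  moreover have "x \<bullet> (covariance_matrix D a *v x) = (?B *v x) \<bullet> (?B *v x)"
    by (simp add: covariance_matrix_def path_matrix_def[symmetric] dot_lmul_matrix[symmetric]
        matrix_vector_mul_assoc[symmetric] inner_commute)
  ultimately have "?B *v x = 0" by simp
  moreover have "(Finite_Cartesian_Product.mat 1 - weight_matrix D a) ** ?B = Finite_Cartesian_Product.mat 1"
    unfolding path_matrix_def
    by (rule matrix_inv_right) (rule invertible_one_minus_weight_matrix[OF assms(1)])
  ultimately have "x = 0"
    by (metis matrix_left_right_inverse matrix_left_invertible_ker)
  with assms show False by simp
qed

text \<open>The brackets are one expression, taken in row \<open>k\<close> and in row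
  \<open>i\<close>: a rank one change in the columns, followed by adding \<open>u k\<close> times
  row \<open>i\<close> to row \<open>k\<close>. The two determinant lemmas apply to these two
  steps.\<close>

lemma covariance_matrix_update:
  fixes D :: "('v::finite \<times> 'v) set" and a :: "'v \<times> 'v \<Rightarrow> real" and t :: real
  assumes D: "acyclic D" and e: "(i, m) \<in> D"
  defines "u \<equiv> \<lambda>l. (t - a (i, m)) * path_matrix D a $ m $ l"
  shows "covariance_matrix D (a((i, m) := t)) $ k $ l =
    (covariance_matrix D a $ k $ l + covariance_matrix D a $ k $ i * u l) +
      u k * (covariance_matrix D a $ i $ l + covariance_matrix D a $ i $ i * u l)"
proof -
  let ?B = "path_matrix D a"
  have "covariance_matrix D (a((i, m) := t)) $ k $ l =
      (\<Sum>p\<in>UNIV. (?B $ p $ k * ?B $ p $ l + ?B $ p $ k * ?B $ p $ i * u l) +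
        u k * (?B $ p $ i * ?B $ p $ l + ?B $ p $ i * ?B $ p $ i * u l))"
    unfolding covariance_matrix_nth path_matrix_update[OF D e] u_def
    by (rule sum.cong[OF refl]) (simp only: algebra_simps)
  then show ?thesis
    by (simp only: covariance_matrix_nth sum.distrib sum_distrib_left[symmetric] sum_distrib_right[symmetric])
qed

section \<open>The minor as an affine function of one weight, and its cofactors\<close>

lemma bij_betw_sorted_list_of_set_nth:
  "finite K \<Longrightarrow> bij_betw ((!) (sorted_list_of_set K)) {..<card K} K"
  by (rule bij_betw_nth) auto

text \<open>The bordering column of covariances with \<open>i\<close> comes last, so this is only up to sign the minor
  with column \<open>c\<close> replaced by it. Here \<open>c\<close> is the position of a column, not a vertex.\<close>

definition minor_cofactor ::
    "('v::{finite,linorder} \<times> 'v) set \<Rightarrow> 'v \<Rightarrow> 'v \<Rightarrow> 'v set \<Rightarrow> ('v \<times> 'v \<Rightarrow> real) \<Rightarrow> nat \<Rightarrow> real" where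
  "minor_cofactor D i j S a c =
    (let n = card (insert i S) in
     cofactor (four_block_mat (sub_matrix (covariance_matrix D a) (insert i S) (insert j S))
       (Matrix.mat n 1 (\<lambda>(r, _). covariance_matrix D a $ (sorted_list_of_set (insert i S) ! r) $ i))
       (0\<^sub>m 1 n) (1\<^sub>m 1)) n c)"

lemma conditional_minor_update:
  fixes D :: "('v::{finite,linorder} \<times> 'v) set"
  assumes D: "acyclic D" and e: "(i, m) \<in> D" and S: "i \<notin> S" "j \<notin> S"
  shows "conditional_minor D i j S (a((i, m) := t)) = conditional_minor D i j S a -
    (t - a (i, m)) * (\<Sum>c < card (insert j S).
      path_matrix D a $ m $ (sorted_list_of_set (insert j S) ! c) * minor_cofactor D i j S a c)"
proof -
  define n where "n = card (insert i S)"
  have n: "card (insert j S) = n" "card (insert i S) = n" using S by (auto simp: n_def)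
  let ?k = "(!) (sorted_list_of_set (insert i S))"
  let ?l = "(!) (sorted_list_of_set (insert j S))"
  let ?C = "covariance_matrix D a"
  define u where "u l = (t - a (i, m)) * path_matrix D a $ m $ l" for l
  define A where "A = sub_matrix ?C (insert i S) (insert j S)"
  \<comment> \<open>Only the column part of the update; the row part is undone by row operations,
    since \<open>i\<close> indexes a row of the minor, at position \<open>p\<close>.\<close>
  define A' where "A' = A + Matrix.mat n n (\<lambda>(r, c). ?C $ ?k r $ i * u (?l c))"
  have A: "A \<in> carrier_mat n n" and A'c: "A' \<in> carrier_mat n n"
    by (auto simp: A_def A'_def sub_matrix_def n)
  have A': "A' $$ (r, c) = ?C $ ?k r $ ?l c + ?C $ ?k r $ i * u (?l c)" if "r < n" "c < n" for r c
    using that by (simp add: A'_def A_def sub_matrix_def n)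
  obtain p where p: "p < n" "?k p = i"
    using bij_betw_sorted_list_of_set_nth[OF finite, of "insert i S"] unfolding n
    by (metis bij_betw_def imageE insertI1 lessThan_iff)
  \<comment> \<open>By acyclicity \<open>u i = 0\<close>, so the row operations leave the pivot row
    \<open>i\<close> fixed.\<close>
  have "(m, i) \<notin> D\<^sup>*"
    using D e by (meson acyclic_def rtrancl_into_trancl2)
  then have "u i = 0"
    using path_matrix_support[OF D] by (auto simp: u_def)
  have "sub_matrix (covariance_matrix D (a((i, m) := t))) (insert i S) (insert j S) =
      Matrix.mat n n (\<lambda>(r, c). A' $$ (r, c) + u (?k r) * A' $$ (p, c))"
    using p by (intro eq_matI) (auto simp: sub_matrix_def n A' covariance_matrix_update[OF D e] u_def)
  then have "conditional_minor D i j S (a((i, m) := t)) = Determinant.det A'"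
    unfolding conditional_minor_def using det_add_multiples_of_row[OF A'c p(1), of "\<lambda>r. u (?k r)"] p \<open>u i = 0\<close>
    by simp
  also have "\<dots> = Determinant.det A - (\<Sum>c<n. u (?l c) * minor_cofactor D i j S a c)"
    unfolding A'_def det_rank_one_update[OF A] by (simp add: minor_cofactor_def A_def n)
  finally show ?thesis
    by (simp add: conditional_minor_def A_def u_def n sum_distrib_left mult.assoc)
qed

lemma partial_deriv_conditional_minor:
  fixes D :: "('v::{finite,linorder} \<times> 'v) set"
  assumes "acyclic D" "(i, m) \<in> D" "i \<notin> S" "j \<notin> S"
  shows "partial_deriv (i, m) (conditional_minor D i j S) a =
    - (\<Sum>c < card (insert j S).
      path_matrix D a $ m $ (sorted_list_of_set (insert j S) ! c) * minor_cofactor D i j S a c)"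
proof -
  have "deriv (\<lambda>t. F - (t - x) * K) x = - K" for F K x :: real
    by (rule DERIV_imp_deriv) (auto intro!: derivative_eq_intros)
  then show ?thesis
    unfolding partial_deriv_def conditional_minor_update[OF assms] .
qed

text \<open>Deleting the column of \<open>j\<close> from the bordered matrix leaves the columns of
  \<open>S\<close> followed by that of \<open>i\<close>: up to column order, the principal submatrix
  on \<open>insert i S\<close>, which is nonsingular by definiteness.\<close>

lemma minor_cofactor_ne_0:
  fixes D :: "('v::{finite,linorder} \<times> 'v) set"
  assumes D: "acyclic D" and S: "i \<notin> S" "j \<notin> S" "i \<noteq> j"
    and c0: "c0 < card (insert j S)" "sorted_list_of_set (insert j S) ! c0 = j"
  shows "minor_cofactor D i j S a c0 \<noteq> 0"
proof -
  define n where "n = card (insert i S)"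
  have n: "card (insert j S) = n" "card (insert i S) = n" "n = Suc (card S)"
    using S by (auto simp: n_def)
  let ?k = "(!) (sorted_list_of_set (insert i S))"
  let ?l = "(!) (sorted_list_of_set (insert j S))"
  let ?C = "covariance_matrix D a"
  let ?W = "four_block_mat (sub_matrix ?C (insert i S) (insert j S))
       (Matrix.mat n 1 (\<lambda>(r, _). ?C $ ?k r $ i)) (0\<^sub>m 1 n) (1\<^sub>m 1)"
  \<comment> \<open>The columns after deletion: position \<open>c0\<close> is skipped, and the
    bordering column \<open>i\<close> lands at the last position,
    \<open>card S = n - 1\<close>.\<close>
  define l' where "l' c = (if c < card S then ?l (if c < c0 then c else Suc c) else i)" for c
  have k: "bij_betw ?k {..<n} (insert i S)"
    using bij_betw_sorted_list_of_set_nth[of "insert i S"] n by simp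
  have l: "bij_betw ?l {..<n} (insert j S)"
    using bij_betw_sorted_list_of_set_nth[of "insert j S"] n by simp
  have l_inj: "?l x = ?l y \<longleftrightarrow> x = y" if "x < n" "y < n" for x y
    using l that by (auto simp: bij_betw_def inj_on_eq_iff)
  have l_in: "?l x \<in> insert j S" if "x < n" for x
    using l that by (auto simp: bij_betw_def)
  have l_S: "?l x \<in> S" if "x < n" "x \<noteq> c0" for x
    using l_in[of x] l_inj[of x c0] that c0 n by auto
  have l'_S: "l' c \<in> S" if "c < card S" for c
    using that l_S[of "if c < c0 then c else Suc c"] n by (auto simp: l'_def)
  have "inj_on l' {..<n}"
  proof (rule inj_onI)
    fix x y assume xy: "x \<in> {..<n}" "y \<in> {..<n}" "l' x = l' y"
    consider "x < card S" "y < card S" | "x = card S" "y = card S"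
      | "x < card S" "y = card S" | "x = card S" "y < card S"
      using xy n by fastforce
    then show "x = y"
    proof cases
      case 1
      let ?x = "if x < c0 then x else Suc x" and ?y = "if y < c0 then y else Suc y"
      have "?x < n" "?y < n" using 1 n by auto
      moreover have "?l ?x = ?l ?y"
        using xy(3) 1 unfolding l'_def by (simp only: if_True)
      ultimately have "?x = ?y" using l_inj by blast
      then show ?thesis by (auto split: if_splits)
    next
      case 3
      then show ?thesis using l'_S[of x] xy S by (auto simp: l'_def)
    next
      case 4
      then show ?thesis using l'_S[of y] xy S by (auto simp: l'_def)
    qed simp
  qed
  moreover have "l' ` {..<n} \<subseteq> insert i S"
    using l'_S by (auto simp: l'_def)
  ultimately have l': "bij_betw l' {..<n} (insert i S)"
    unfolding bij_betw_def using n by (simp add: card_subset_eq card_image)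
  have "mat_delete ?W n c0 = Matrix.mat n n (\<lambda>(r, c). ?C $ ?k r $ l' c)"
    using n c0 by (intro eq_matI) (auto simp: mat_delete_def sub_matrix_def l'_def)
  then show ?thesis
    using det_reindexed_principal_ne_0[OF covariance_matrix_definite[OF D] k l', of a]
    by (simp add: minor_cofactor_def cofactor_def n)
qed

section \<open>Solving the unitriangular system of vanishing partial derivatives\<close>

theorem mainTheorem1:
  fixes D :: "('v::{finite,linorder} \<times> 'v) set"
    and i\<^sub>0 j\<^sub>0 :: 'v
    and S :: "'v set"
  assumes "acyclic D"
    and "i\<^sub>0 \<noteq> j\<^sub>0"
    and "S \<subseteq> UNIV - {i\<^sub>0, j\<^sub>0}"
    and "\<exists>a \<in> parameter_space D. conditional_minor D i\<^sub>0 j\<^sub>0 S a \<noteq> 0"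
    and "(i\<^sub>0, j\<^sub>0) \<in> D"
    and "\<forall>s\<in>S. (j\<^sub>0, s) \<in> D\<^sup>+ \<longrightarrow> (i\<^sub>0, s) \<in> D"
  shows "nonsingular_hypersurface D (conditional_minor D i\<^sub>0 j\<^sub>0 S)"
  unfolding nonsingular_hypersurface_def
proof
  let ?n = "card (insert j\<^sub>0 S)"
  let ?l = "(!) (sorted_list_of_set (insert j\<^sub>0 S))"
  assume "\<exists>a\<in>zero_locus D (conditional_minor D i\<^sub>0 j\<^sub>0 S).
    \<forall>e\<in>D. partial_deriv e (conditional_minor D i\<^sub>0 j\<^sub>0 S) a = 0"
  then obtain a where crit: "\<And>e. e \<in> D \<Longrightarrow> partial_deriv e (conditional_minor D i\<^sub>0 j\<^sub>0 S) a = 0"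
    by blast
  let ?B = "path_matrix D a" and ?C = "minor_cofactor D i\<^sub>0 j\<^sub>0 S a"
  have S: "i\<^sub>0 \<notin> S" "j\<^sub>0 \<notin> S" using assms by auto
  have l: "bij_betw ?l {..<?n} (insert j\<^sub>0 S)"
    by (rule bij_betw_sorted_list_of_set_nth) simp
  \<comment> \<open>The condition \<open>(j\<^sub>0, m) \<in> D\<^sup>*\<close> restricts to the
    columns in \<open>U\<close>; the system is solved from the sinks up.\<close>
  have zero: "\<forall>c<?n. ?l c = m \<longrightarrow> (j\<^sub>0, m) \<in> D\<^sup>* \<longrightarrow> ?C c = 0" for m
  proof (rule finite_acyclic_converse_induct[OF assms(1),
        where P = "\<lambda>m. \<forall>c<?n. ?l c = m \<longrightarrow> (j\<^sub>0, m) \<in> D\<^sup>* \<longrightarrow> ?C c = 0"], intro allI impI)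
    fix m c
    assume IH: "\<And>m'. (m, m') \<in> D\<^sup>+ \<Longrightarrow> \<forall>c<?n. ?l c = m' \<longrightarrow> (j\<^sub>0, m') \<in> D\<^sup>* \<longrightarrow> ?C c = 0"
      and c: "c < ?n" "?l c = m" and m: "(j\<^sub>0, m) \<in> D\<^sup>*"
    have "m \<in> insert j\<^sub>0 S"
      using l c by (auto simp: bij_betw_def)
    \<comment> \<open>Either \<open>m = j\<^sub>0\<close>, or \<open>m\<close> lies in
      \<open>S\<close> below \<open>j\<^sub>0\<close>; both hypotheses on edges out of
      \<open>i\<^sub>0\<close> enter here.\<close>
    then have "(i\<^sub>0, m) \<in> D"
      using assms(5,6) m by (auto simp: rtrancl_eq_or_trancl)
    then have "0 = (\<Sum>c<?n. ?B $ m $ ?l c * ?C c)"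
      using partial_deriv_conditional_minor[OF assms(1) _ S] crit by fastforce
    also have "\<dots> = ?B $ m $ ?l c * ?C c + (\<Sum>c'\<in>{..<?n} - {c}. ?B $ m $ ?l c' * ?C c')"
      using c by (intro sum.remove) auto
    \<comment> \<open>A nonzero path entry makes \<open>?l c'\<close> a proper descendant of
      \<open>m\<close>, hence also below \<open>j\<^sub>0\<close>, where the induction hypothesis
      kills the cofactor.\<close>
    also have "(\<Sum>c'\<in>{..<?n} - {c}. ?B $ m $ ?l c' * ?C c') = 0"
    proof (rule sum.neutral, rule ballI)
      fix c' assume c': "c' \<in> {..<?n} - {c}"
      then have "?l c' \<noteq> m"
        using l c by (auto simp: bij_betw_def inj_on_def)
      show "?B $ m $ ?l c' * ?C c' = 0"
      proof (cases "?B $ m $ ?l c' = 0")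
        case False
        then have "(m, ?l c') \<in> D\<^sup>*"
          by (rule path_matrix_support[OF assms(1)])
        with \<open>?l c' \<noteq> m\<close> have "(m, ?l c') \<in> D\<^sup>+"
          by (auto simp: rtrancl_eq_or_trancl)
        then have "?C c' = 0"
          using IH c' rtrancl_trans[OF m \<open>(m, ?l c') \<in> D\<^sup>*\<close>] by blast
        then show ?thesis by simp
      qed simp
    qed
    finally show "?C c = 0"
      using c by (simp add: path_matrix_diag[OF assms(1)])
  qed
  \<comment> \<open>The contradiction arises at the column of \<open>j\<^sub>0\<close> itself, whose
    cofactor is a nonzero principal minor up to sign.\<close>
  obtain c0 where "c0 < ?n" "?l c0 = j\<^sub>0"
    using l by (metis bij_betw_def imageE insertI1 lessThan_iff)
  then show False
    using zero minor_cofactor_ne_0[OF assms(1) S assms(2)] by blast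
qed

end
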